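(* Let $K$ be a knot. Then $$\frac{\mathrm{spn}(K)-1}{2}\le \mathrm{dalt}(K).$$
   Context: All knots and knot diagrams are oriented, and diagrams lie on $S^2$. A base point $b$ of a knot diagram $D$ is a point of $D$ that is not a crossing point. A crossing point of $D$ is a warping crossing point of $D_b=(D,b)$ if, going along $D$ following its orientation starting from $b$, one meets that crossing first as an under-crossing. The warping degree $d(D_b)$ is the number of warping crossing points of $D_b$. An edge of $D$ is a path on $D$ between (consecutive) crossing points with no crossings in its interior; for the diagram with no crossings, the whole circle counts as one edge. The warping degree $i(e)$ of an edge $e$ is $d(D_b)$ for any base point $b$ on $e$. The warping polynomial of $D$ is $W_D(t)=\sum_e t^{i(e)}$, the sum over all edges $e$ of $D$. The span of $D$, $\mathrm{spn}(D)$, is the difference between the highest and lowest degrees of terms of $W_D(t)$; equivalently $\mathrm{spn}(D)=\max_b d(D_b)-\min_b d(D_b)$. The span $\mathrm{spn}(K)$ of a knot $K$ is the minimum of $\mathrm{spn}(D)$ over all diagrams $D$ of $K$. A diagram is alternating if over- and under-crossings alternate along it (the crossingless diagram is regarded as alternating). The dealternating number $\mathrm{dalt}(D)$ of a knot diagram $D$ is the minimal number of crossing changes needed to obtain an alternating diagram from $D$, and $\mathrm{dalt}(K)$ is the minimum of $\mathrm{dalt}(D)$ over all diagrams $D$ of $K$. *)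

theory Defs
  imports "HOL-Analysis.Analysis" "HOL-Computational_Algebra.Polynomial"
begin

text \<open>
  Oriented closed curves are \<open>1\<close>-periodic maps on the real line, oriented by increasing
  parameter; two parameters give the same point of the circle iff they differ by an integer.
\<close>

definition regular_closed_curve :: "(real \<Rightarrow> real^3) \<Rightarrow> bool" where
  "regular_closed_curve g \<longleftrightarrow>
     g C1_differentiable_on UNIV \<and>
     (\<forall>t. g (t + 1) = g t) \<and>
     (\<forall>t. vector_derivative g (at t) \<noteq> 0)"

definition knot :: "(real \<Rightarrow> real^3) \<Rightarrow> bool" where
  "knot K \<longleftrightarrow> regular_closed_curve K \<and> (\<forall>s t. K s = K t \<longrightarrow> s - t \<in> \<int>)"

text \<open>
  Ambient isotopy of oriented knots; \<open>\<phi>\<close> is an orientation-preserving reparametrisation of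
  the circle.
\<close>

definition ambient_isotopic :: "(real \<Rightarrow> real^3) \<Rightarrow> (real \<Rightarrow> real^3) \<Rightarrow> bool" where
  "ambient_isotopic K L \<longleftrightarrow>
     (\<exists>(H :: real \<Rightarrow> real^3 \<Rightarrow> real^3) (\<phi> :: real \<Rightarrow> real).
        continuous_on ({0..1} \<times> UNIV) (\<lambda>(u, x). H u x) \<and>
        (\<forall>u\<in>{0..1}. \<exists>G. homeomorphism UNIV UNIV (H u) G) \<and>
        (\<forall>x. H 0 x = x) \<and>
        continuous_on UNIV \<phi> \<and> strict_mono \<phi> \<and> (\<forall>t. \<phi> (t + 1) = \<phi> t + 1) \<and>
        (\<forall>t. H 1 (K t) = L (\<phi> t)))"

text \<open>
  A diagram is a generic closed curve on the unit sphere together with the set of those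
  parameters at which the curve passes a crossing point as the over-strand.
\<close>

record diagram =
  curve :: "real \<Rightarrow> real^3"
  over :: "real set"

definition crossings :: "diagram \<Rightarrow> (real^3) set" where
  "crossings D = {curve D t | t. \<exists>s. s - t \<notin> \<int> \<and> curve D s = curve D t}"

definition knot_diagram :: "diagram \<Rightarrow> bool" where
  "knot_diagram D \<longleftrightarrow>
     regular_closed_curve (curve D) \<and>
     range (curve D) \<subseteq> sphere 0 1 \<and>
     finite (crossings D) \<and>
     (\<forall>c\<in>crossings D. card {t\<in>{0..<1}. curve D t = c} = 2) \<and>
     (\<forall>s t. s - t \<notin> \<int> \<and> curve D s = curve D t \<longrightarrow>
        \<not> collinear {0, vector_derivative (curve D) (at s), vector_derivative (curve D) (at t)}) \<and>
     over D \<subseteq> {t. curve D t \<in> crossings D} \<and>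
     (\<forall>t. t + 1 \<in> over D \<longleftrightarrow> t \<in> over D) \<and>
     (\<forall>s t. s - t \<notin> \<int> \<and> curve D s = curve D t \<longrightarrow> (s \<in> over D \<longleftrightarrow> t \<notin> over D))"

text \<open>
  The complement of the origin is the product of the sphere (direction \<open>sgn x\<close>) with a line
  (distance \<open>norm x\<close>).  A diagram on the sphere is seen from outside, so the over-strand at a
  crossing is the one farther from the origin.
\<close>

definition diagram_of :: "diagram \<Rightarrow> (real \<Rightarrow> real^3) \<Rightarrow> bool" where
  "diagram_of D K \<longleftrightarrow>
     knot_diagram D \<and>
     (\<exists>L. knot L \<and> ambient_isotopic K L \<and>
        (\<forall>t. sgn (L t) = curve D t) \<and>
        (\<forall>s t. s - t \<notin> \<int> \<and> curve D s = curve D t \<longrightarrow>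
           (t \<in> over D \<longleftrightarrow> norm (L s) < norm (L t))))"

definition warping_crossings :: "diagram \<Rightarrow> real^3 \<Rightarrow> (real^3) set" where
  "warping_crossings D b = {c \<in> crossings D.
     \<exists>u s t. curve D u = b \<and> u < s \<and> s < t \<and> t < u + 1 \<and>
             curve D s = c \<and> curve D t = c \<and> s \<notin> over D}"

definition warping_degree :: "diagram \<Rightarrow> real^3 \<Rightarrow> nat" where
  "warping_degree D b = card (warping_crossings D b)"

definition consecutive :: "diagram \<Rightarrow> real \<Rightarrow> real \<Rightarrow> bool" where
  "consecutive D s t \<longleftrightarrow>
     s < t \<and> curve D s \<in> crossings D \<and> curve D t \<in> crossings D \<and>
     (\<forall>u\<in>{s<..<t}. curve D u \<notin> crossings D)"

definition edges :: "diagram \<Rightarrow> (real^3) set set" where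
  "edges D = (if crossings D = {} then {range (curve D)}
              else {curve D ` {s..t} | s t. consecutive D s t})"

text \<open>The warping degree is the same for all base points on an edge, so any choice will do.\<close>

definition edge_warping_degree :: "diagram \<Rightarrow> (real^3) set \<Rightarrow> nat" where
  "edge_warping_degree D e = warping_degree D (SOME b. b \<in> e - crossings D)"

definition warping_polynomial :: "diagram \<Rightarrow> int poly" where
  "warping_polynomial D = (\<Sum>e\<in>edges D. monom 1 (edge_warping_degree D e))"

definition diagram_span :: "diagram \<Rightarrow> nat" where
  "diagram_span D =
     Max {n. coeff (warping_polynomial D) n \<noteq> 0} - Min {n. coeff (warping_polynomial D) n \<noteq> 0}"

definition alternating :: "diagram \<Rightarrow> bool" where
  "alternating D \<longleftrightarrow> (\<forall>s t. consecutive D s t \<longrightarrow> (s \<in> over D \<longleftrightarrow> t \<notin> over D))"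

definition change_crossings :: "(real^3) set \<Rightarrow> diagram \<Rightarrow> diagram" where
  "change_crossings C D =
     D\<lparr>over := {t. curve D t \<in> crossings D \<and> (t \<in> over D \<longleftrightarrow> curve D t \<notin> C)}\<rparr>"

text \<open>
  The minima below are infima in \<^typ>\<open>enat\<close>: an infimum of a nonempty set is attained, and no
  artificial finite value is assigned to a minimum over an empty set.
\<close>

definition diagram_dalt :: "diagram \<Rightarrow> enat" where
  "diagram_dalt D =
     (INF C \<in> {C. C \<subseteq> crossings D \<and> alternating (change_crossings C D)}. enat (card C))"

definition knot_span :: "(real \<Rightarrow> real^3) \<Rightarrow> enat" where
  "knot_span K = (INF D \<in> {D. diagram_of D K}. enat (diagram_span D))"

definition knot_dalt :: "(real \<Rightarrow> real^3) \<Rightarrow> enat" where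
  "knot_dalt K = (INF D \<in> {D. diagram_of D K}. diagram_dalt D)"

end

theory Submission
  imports Defs
begin

text \<open>
  Slide the base point once along a diagram.  The warping degree is constant along edges; when the
  base point passes over a crossing that crossing turns from one met first from above into one met
  first from below, so the degree rises by one, and when it passes under a crossing the degree
  falls by one (\<open>warping_degree_pass\<close>).  In an alternating
  diagram the rises and falls alternate, so that any two base points have warping degrees that differ
  by at most one (\<open>alternating_warping_degree_le\<close>).

  Changing the crossings in a set \<open>C\<close> affects, for a fixed base point, only the members of \<open>C\<close>, and
  hence moves the warping degree by at most \<open>card C\<close>
  (\<open>warping_degree_change_crossings_le\<close>).  If the changed diagram is alternating,
  comparing two base points through it costs \<open>card C\<close> at each of them and at most one in between:
  the span of the diagram is at most \<open>2 * card C + 1\<close> (\<open>diagram_span_le\<close>).  Applied to a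
  diagram and a set of crossings that realise the dealternating number of the knot, this bounds the
  span of the knot.
\<close>

section \<open>Crossing parameters\<close>

definition crossing_params :: "diagram \<Rightarrow> real set" where
  "crossing_params D = {t. curve D t \<in> crossings D}"

lemma curve_add_int:
  assumes "knot_diagram D"
  shows "curve D (t + of_int n) = curve D t"
proof -
  have per: "curve D (x + 1) = curve D x" for x
    using assms by (simp add: knot_diagram_def regular_closed_curve_def)
  have nat: "curve D (x + of_nat k) = curve D x" for x k
  proof (induction k)
    case (Suc k)
    then show ?case using per[of "x + of_nat k"] by (simp add: add_ac)
  qed simp
  show ?thesis
  proof (cases "n \<ge> 0")
    case True
    then show ?thesis using nat[of t "nat n"] by simp
  next
    case False
    then show ?thesis using nat[of "t + of_int n" "nat (- n)"] by simp
  qed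
qed

lemma curve_eq_if_diff_Ints:
  assumes "knot_diagram D" "s - t \<in> \<int>"
  shows "curve D s = curve D t"
proof -
  obtain n where "s - t = of_int n" using assms(2) by (auto elim: Ints_cases)
  then have "s = t + of_int n" by simp
  then show ?thesis using curve_add_int[OF assms(1)] by simp
qed

lemma curve_frac:
  assumes "knot_diagram D"
  shows "curve D (frac t) = curve D t"
  by (rule curve_eq_if_diff_Ints[OF assms]) (simp add: frac_def)

lemma over_iff_not_over:
  assumes "knot_diagram D" "s - t \<notin> \<int>" "curve D s = curve D t"
  shows "s \<in> over D \<longleftrightarrow> t \<notin> over D"
  using assms by (auto simp: knot_diagram_def)

lemma diff_less_one_notin_Ints:
  fixes s t :: real
  assumes "s < t" "t < s + 1"
  shows "t - s \<notin> \<int>"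
proof
  assume "t - s \<in> \<int>"
  then obtain n where "t - s = of_int n" by (auto elim: Ints_cases)
  then have "(0::real) < of_int n" "of_int n < (1::real)" using assms by auto
  then show False by simp
qed

text \<open>
  Three such parameters would have distinct fractional parts, but a crossing has exactly two
  parameters in the unit interval.
\<close>

lemma no_triple_point:
  assumes kd: "knot_diagram D"
    and ord: "r < s" "s < t" "t < r + 1"
    and eq: "curve D r = curve D s" "curve D t = curve D s"
  shows False
proof -
  let ?P = "{x\<in>{0..<1}. curve D x = curve D s}"
  have "s - r \<notin> \<int>" using ord by (intro diff_less_one_notin_Ints) auto
  then have "curve D s \<in> crossings D"
    using eq Ints_minus[of "r - s"] unfolding crossings_def by force
  then have card: "card ?P = 2" using kd by (simp add: knot_diagram_def)
  have neq: "frac x \<noteq> frac y" if "x < y" "y < x + 1" for x y :: real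
  proof
    assume "frac x = frac y"
    then have "y - x = of_int (\<lfloor>y\<rfloor> - \<lfloor>x\<rfloor>)" by (simp add: frac_def)
    then have "y - x \<in> \<int>" by (metis Ints_of_int)
    with diff_less_one_notin_Ints that show False by blast
  qed
  have "frac r \<noteq> frac s" "frac s \<noteq> frac t" "frac r \<noteq> frac t"
    using neq[of r s] neq[of s t] neq[of r t] ord by simp_all
  then have "card {frac r, frac s, frac t} = 3" by simp
  moreover have "{frac r, frac s, frac t} \<subseteq> ?P"
    using eq by (auto simp: curve_frac[OF kd] frac_lt_1)
  then have "card {frac r, frac s, frac t} \<le> card ?P"
    using card by (intro card_mono) (auto intro: card_ge_0_finite)
  ultimately show False using card by simp
qed

lemma second_passage:
  assumes kd: "knot_diagram D" and "s \<in> crossing_params D"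
  obtains t where "s < t" "t < s + 1" "curve D t = curve D s"
proof -
  obtain s' r where sr: "curve D s' = curve D s" "r - s' \<notin> \<int>" "curve D r = curve D s'"
    using assms(2) unfolding crossing_params_def crossings_def by force
  \<comment> \<open>Of two parameters that differ by a non-integer, at least one differs so from \<open>s\<close>.\<close>
  have "\<exists>q. q - s \<notin> \<int> \<and> curve D q = curve D s"
  proof (cases "r - s \<in> \<int>")
    case True
    have "s' - s \<notin> \<int>"
    proof
      assume "s' - s \<in> \<int>"
      then have "(r - s) - (s' - s) \<in> \<int>" using True Ints_diff by blast
      then show False using sr by simp
    qed
    then show ?thesis using sr by auto
  qed (use sr in auto)
  then obtain q where q: "q - s \<notin> \<int>" "curve D q = curve D s" by blast
  let ?t = "s + frac (q - s)"
  have "?t - q \<in> \<int>" by (simp add: frac_def)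
  then have "curve D ?t = curve D s" using q curve_eq_if_diff_Ints[OF kd] by simp
  moreover have "s < ?t" "?t < s + 1" using q by (auto simp: frac_lt_1)
  ultimately show thesis using that by blast
qed

lemma crossing_params_add_int:
  assumes "knot_diagram D" "t \<in> crossing_params D"
  shows "t + of_int n \<in> crossing_params D"
  using assms curve_add_int by (simp add: crossing_params_def)

lemma finite_crossing_params_Icc:
  assumes kd: "knot_diagram D"
  shows "finite (crossing_params D \<inter> {a..b})"
proof -
  let ?P = "\<Union>c\<in>crossings D. {t\<in>{0..<1}. curve D t = c}"
  have fin: "finite ?P"
  proof (intro finite_UN_I)
    show "finite (crossings D)" using kd by (simp add: knot_diagram_def)
    fix c assume "c \<in> crossings D"
    then have "card {t\<in>{0..<1}. curve D t = c} = 2" using kd by (simp add: knot_diagram_def)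
    then show "finite {t\<in>{0..<1}. curve D t = c}" by (intro card_ge_0_finite) simp
  qed
  have "crossing_params D \<inter> {a..b} \<subseteq> (\<lambda>(x, n). x + of_int n) ` (?P \<times> {\<lfloor>a\<rfloor>..\<lfloor>b\<rfloor>})"
  proof
    fix t assume t: "t \<in> crossing_params D \<inter> {a..b}"
    then have "frac t \<in> ?P"
      using curve_frac[OF kd] by (auto simp: crossing_params_def frac_lt_1)
    moreover have "\<lfloor>t\<rfloor> \<in> {\<lfloor>a\<rfloor>..\<lfloor>b\<rfloor>}" using t by (auto intro: floor_mono)
    moreover have "t = frac t + of_int \<lfloor>t\<rfloor>" by (simp add: frac_def)
    ultimately show "t \<in> (\<lambda>(x, n). x + of_int n) ` (?P \<times> {\<lfloor>a\<rfloor>..\<lfloor>b\<rfloor>})"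
      by (intro image_eqI[where x = "(frac t, \<lfloor>t\<rfloor>)"]) auto
  qed
  then show ?thesis by (rule finite_subset) (use fin in simp)
qed

lemma next_crossing_param:
  assumes kd: "knot_diagram D" and "q \<in> crossing_params D" "a < q"
  obtains p where "p \<in> crossing_params D" "a < p" "p \<le> q"
    "\<And>r. a < r \<Longrightarrow> r < p \<Longrightarrow> r \<notin> crossing_params D"
proof -
  let ?S = "crossing_params D \<inter> {a<..q}"
  have "finite ?S"
    by (rule finite_subset[OF _ finite_crossing_params_Icc[OF kd, of a q]]) auto
  moreover have "q \<in> ?S" using assms by auto
  ultimately have "Min ?S \<in> ?S" and min: "\<And>r. r \<in> ?S \<Longrightarrow> Min ?S \<le> r"
    using Min_in by (blast, simp)
  show thesis
  proof (rule that[of "Min ?S"])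
    fix r assume r: "a < r" "r < Min ?S"
    show "r \<notin> crossing_params D"
    proof
      assume "r \<in> crossing_params D"
      then have "r \<in> ?S" using r \<open>Min ?S \<in> ?S\<close> by auto
      with min[of r] r show False by simp
    qed
  qed (use \<open>Min ?S \<in> ?S\<close> in auto)
qed

section \<open>Sliding the base point\<close>

text \<open>
  Once the base point is given by a parameter, warping is decided by the first passage after it
  alone.  In this form a crossing keeps its status while the base point does not pass it.
\<close>

lemma warping_crossings_first_passage:
  assumes kd: "knot_diagram D" and u: "u \<notin> crossing_params D"
  shows "c \<in> warping_crossings D (curve D u) \<longleftrightarrow>
    c \<in> crossings D \<and> (\<exists>s>u. curve D s = c \<and> s \<notin> over D \<and> (\<forall>r\<in>{u<..<s}. curve D r \<noteq> c))"
    (is "_ \<longleftrightarrow> ?R")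
proof
  assume "c \<in> warping_crossings D (curve D u)"
  then obtain v s t where c: "c \<in> crossings D" and v: "curve D v = curve D u"
    and st: "v < s" "s < t" "t < v + 1" "curve D s = c" "curve D t = c" "s \<notin> over D"
    unfolding warping_crossings_def by blast
  \<comment> \<open>The base point is a simple point of the curve, so its parameters differ by an integer.\<close>
  have "v - u \<in> \<int>"
    using u v unfolding crossing_params_def crossings_def by fastforce
  then obtain n where n: "v = u + of_int n"
    by (metis Ints_cases add.commute diff_add_cancel)
  let ?s = "s - of_int n" and ?t = "t - of_int n"
  have cs: "curve D ?s = c" "curve D ?t = c"
    using curve_add_int[OF kd, of s "- n"] curve_add_int[OF kd, of t "- n"] st by simp_all
  have "?s \<notin> over D"
  proof -
    have "t - s \<notin> \<int>" using st by (intro diff_less_one_notin_Ints) auto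
    then have "t - ?s \<notin> \<int>"
      using Ints_diff[of "t - ?s" "of_int n"] by auto
    moreover have "t \<in> over D"
      using over_iff_not_over[OF kd \<open>t - s \<notin> \<int>\<close>] st by simp
    ultimately show ?thesis using over_iff_not_over[OF kd, of t ?s] cs st by simp
  qed
  moreover have "curve D r \<noteq> c" if "r \<in> {u<..<?s}" for r
    using no_triple_point[OF kd, of r ?s ?t] that st cs n by auto
  ultimately show ?R using c cs st n by (intro conjI exI[of _ ?s]) auto
next
  assume ?R
  then obtain s where c: "c \<in> crossings D" and s: "u < s" "curve D s = c" "s \<notin> over D"
    and first: "\<forall>r\<in>{u<..<s}. curve D r \<noteq> c" by blast
  have uc: "curve D u \<noteq> c" using c u by (auto simp: crossing_params_def)
  obtain t where t: "s < t" "t < s + 1" "curve D t = c"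
    using second_passage[OF kd, of s] c s by (auto simp: crossing_params_def)
  have "curve D (t - 1) = c" using curve_add_int[OF kd, of t "-1"] t by simp
  then have "\<not> u \<le> t - 1" using first uc t by (cases "u = t - 1") auto
  then have "t < u + 1" by simp
  then show "c \<in> warping_crossings D (curve D u)"
    unfolding warping_crossings_def using c s t by blast
qed

lemma warping_crossings_not_passed:
  assumes kd: "knot_diagram D" and "u < v"
    and "u \<notin> crossing_params D" "v \<notin> crossing_params D"
    and np: "\<And>r. u < r \<Longrightarrow> r < v \<Longrightarrow> curve D r \<noteq> c"
  shows "c \<in> warping_crossings D (curve D v) \<longleftrightarrow> c \<in> warping_crossings D (curve D u)"
proof (cases "c \<in> crossings D")
  case True
  then have "curve D v \<noteq> c" using assms(4) by (auto simp: crossing_params_def)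
  then have np': "v < r" if "u < r" "curve D r = c" for r
    using np that by (metis linorder_neqE_linordered_idom)
  have "(\<forall>r\<in>{u<..<s}. curve D r \<noteq> c) \<longleftrightarrow> (\<forall>r\<in>{v<..<s}. curve D r \<noteq> c)" for s
    using np' \<open>u < v\<close> by force
  moreover have "s > u \<and> curve D s = c \<longleftrightarrow> s > v \<and> curve D s = c" for s
    using np' \<open>u < v\<close> by force
  ultimately show ?thesis
    unfolding warping_crossings_first_passage[OF kd assms(3)]
      warping_crossings_first_passage[OF kd assms(4)] by blast
qed (simp add: warping_crossings_def)

text \<open>
  Before the base point slides past \<open>p\<close>, the passage at \<open>p\<close> is the first one of its crossing;
  afterwards it is the last, and the opposite strand comes first.
\<close>

lemma warping_crossings_passed:
  assumes kd: "knot_diagram D" and p: "p \<in> crossing_params D" "u < p" "p < v"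
    and uv: "u \<notin> crossing_params D" "v \<notin> crossing_params D"
    and only: "\<And>r. u < r \<Longrightarrow> r < v \<Longrightarrow> r \<in> crossing_params D \<Longrightarrow> r = p"
  shows "curve D p \<in> warping_crossings D (curve D u) \<longleftrightarrow> p \<notin> over D"
    and "curve D p \<in> warping_crossings D (curve D v) \<longleftrightarrow> p \<in> over D"
proof -
  let ?c = "curve D p"
  have c: "?c \<in> crossings D" using p by (simp add: crossing_params_def)
  have cp: "r \<in> crossing_params D" if "curve D r = ?c" for r
    using that c by (simp add: crossing_params_def)
  have first: "\<forall>r\<in>{u<..<p}. curve D r \<noteq> ?c"
  proof (intro ballI notI)
    fix r assume "r \<in> {u<..<p}" "curve D r = ?c"
    then show False using only[of r] cp[of r] p by auto
  qed
  show "?c \<in> warping_crossings D (curve D u) \<longleftrightarrow> p \<notin> over D"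
  proof -
    have "s = p" if "u < s" "curve D s = ?c" "\<forall>r\<in>{u<..<s}. curve D r \<noteq> ?c" for s
      using that first p by (cases s p rule: linorder_cases) auto
    then show ?thesis
      unfolding warping_crossings_first_passage[OF kd uv(1)] using c p first by blast
  qed
  \<comment> \<open>The other passage \<open>q\<close> of the crossing is the first one after \<open>v\<close>.\<close>
  obtain q where q: "p < q" "q < p + 1" "curve D q = ?c"
    using second_passage[OF kd p(1)] by blast
  have "v < q"
    using only[of q] cp[of q] q p uv(2) by (cases v q rule: linorder_cases) auto
  have qover: "q \<in> over D \<longleftrightarrow> p \<notin> over D"
    using over_iff_not_over[OF kd diff_less_one_notin_Ints] q by simp
  have first': "\<forall>r\<in>{v<..<q}. curve D r \<noteq> ?c"
  proof (intro ballI notI)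
    fix r assume "r \<in> {v<..<q}" "curve D r = ?c"
    then show False using no_triple_point[OF kd, of p r q] q p by auto
  qed
  have "s = q" if "v < s" "curve D s = ?c" "\<forall>r\<in>{v<..<s}. curve D r \<noteq> ?c" for s
    using that first' q \<open>v < q\<close> by (cases s q rule: linorder_cases) auto
  then show "?c \<in> warping_crossings D (curve D v) \<longleftrightarrow> p \<in> over D"
    unfolding warping_crossings_first_passage[OF kd uv(2)]
    using c \<open>v < q\<close> q first' qover by blast
qed

lemma finite_warping_crossings:
  assumes "knot_diagram D"
  shows "finite (warping_crossings D b)"
  by (rule finite_subset[of _ "crossings D"]) (use assms in \<open>auto simp: warping_crossings_def knot_diagram_def\<close>)

lemma warping_degree_pass:
  assumes kd: "knot_diagram D" and p: "p \<in> crossing_params D" "u < p" "p < v"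
    and uv: "u \<notin> crossing_params D" "v \<notin> crossing_params D"
    and only: "\<And>r. u < r \<Longrightarrow> r < v \<Longrightarrow> r \<in> crossing_params D \<Longrightarrow> r = p"
  shows "int (warping_degree D (curve D v)) =
    int (warping_degree D (curve D u)) + (if p \<in> over D then 1 else - 1)"
proof -
  let ?c = "curve D p"
  let ?U = "warping_crossings D (curve D u)" and ?V = "warping_crossings D (curve D v)"
  have other: "c \<in> ?V \<longleftrightarrow> c \<in> ?U" if "c \<noteq> ?c" for c
  proof (cases "c \<in> crossings D")
    case True
    then have "curve D r \<noteq> c" if "u < r" "r < v" for r
      using only[OF that] \<open>c \<noteq> ?c\<close> by (auto simp: crossing_params_def)
    then show ?thesis using p uv by (intro warping_crossings_not_passed[OF kd]) auto
  qed (simp add: warping_crossings_def)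
  have self: "?c \<in> ?U \<longleftrightarrow> p \<notin> over D" "?c \<in> ?V \<longleftrightarrow> p \<in> over D"
    using warping_crossings_passed[OF kd p uv only] by blast+
  note fin = finite_warping_crossings[OF kd]
  show ?thesis
  proof (cases "p \<in> over D")
    case True
    have "c \<in> ?V \<longleftrightarrow> c \<in> insert ?c ?U" for c
      using other[of c] self True by (cases "c = ?c") auto
    then have "?V = insert ?c ?U" by blast
    moreover have "?c \<notin> ?U" using True self by blast
    ultimately show ?thesis using True fin by (simp add: warping_degree_def)
  next
    case False
    have "c \<in> ?U \<longleftrightarrow> c \<in> insert ?c ?V" for c
      using other[of c] self False by (cases "c = ?c") auto
    then have "?U = insert ?c ?V" by blast
    moreover have "?c \<notin> ?V" using False self by blast
    ultimately show ?thesis using False fin by (simp add: warping_degree_def)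
  qed
qed

section \<open>Alternating diagrams\<close>

text \<open>
  The changes of the degree form an alternating sequence of \<open>1\<close> and \<open>-1\<close>, so their partial sums
  are zero or equal to the first change.  Remembering the sign of the first change makes the
  induction on the number of passages go through.
\<close>

lemma alternating_warping_degree_diff:
  assumes kd: "knot_diagram D" and alt: "alternating D"
    and "u \<notin> crossing_params D" "v \<notin> crossing_params D"
    and "p \<in> crossing_params D" "u < p" "p < v"
    and "\<And>r. u < r \<Longrightarrow> r < p \<Longrightarrow> r \<notin> crossing_params D"
  shows "int (warping_degree D (curve D v)) - int (warping_degree D (curve D u))
    \<in> {0, if p \<in> over D then 1 else - 1}"
  using assms(3-)
proof (induction "card (crossing_params D \<inter> {u..v})" arbitrary: u p rule: less_induct)
  case less
  show ?case
  proof (cases "\<exists>r \<in> crossing_params D. p < r \<and> r < v")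
    case False
    then have "r = p" if "u < r" "r < v" "r \<in> crossing_params D" for r
      using less.prems(6) that by (metis linorder_neqE_linordered_idom)
    then show ?thesis using warping_degree_pass[OF kd less.prems(3-5,1,2)] by auto
  next
    case True
    then obtain r where "r \<in> crossing_params D" "p < r" "r < v" by blast
    then obtain q where q: "q \<in> crossing_params D" "p < q" "q < v"
      and gap: "\<And>r. p < r \<Longrightarrow> r < q \<Longrightarrow> r \<notin> crossing_params D"
      using next_crossing_param[OF kd, of r p] by (metis order_le_less_trans)
    define w where "w = (p + q) / 2"
    have w: "p < w" "w < q" using q by (auto simp: w_def)
    then have wc: "w \<notin> crossing_params D" using gap by blast
    have "r = p" if "u < r" "r < w" "r \<in> crossing_params D" for r
      using less.prems(6)[of r] gap[of r] that w by force
    then have step: "int (warping_degree D (curve D w)) =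
        int (warping_degree D (curve D u)) + (if p \<in> over D then 1 else - 1)"
      by (rule warping_degree_pass[OF kd less.prems(3,4) w(1) less.prems(1) wc])
    have "crossing_params D \<inter> {w..v} \<subset> crossing_params D \<inter> {u..v}"
      using less.prems(3-5) w by force
    then have "card (crossing_params D \<inter> {w..v}) < card (crossing_params D \<inter> {u..v})"
      by (intro psubset_card_mono finite_crossing_params_Icc[OF kd])
    from less.hyps[OF this wc less.prems(2) q(1) w(2) q(3)]
    have rest: "int (warping_degree D (curve D v)) - int (warping_degree D (curve D w))
        \<in> {0, if q \<in> over D then 1 else - 1}"
      using gap w by auto
    have "consecutive D p q"
      using less.prems q gap by (auto simp: consecutive_def crossing_params_def)
    then have "p \<in> over D \<longleftrightarrow> q \<notin> over D" using alt by (simp add: alternating_def)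
    then show ?thesis using step rest by (auto split: if_splits)
  qed
qed

text \<open>
  Unlike the previous lemma this is free of the sign, so it holds for base points in either order
  and covers those with no passage in between.
\<close>

lemma alternating_warping_degree_le:
  assumes kd: "knot_diagram D" and alt: "alternating D"
    and uv: "u \<notin> crossing_params D" "v \<notin> crossing_params D"
  shows "warping_degree D (curve D u) \<le> warping_degree D (curve D v) + 1"
proof -
  have diff: "\<bar>int (warping_degree D (curve D y)) - int (warping_degree D (curve D x))\<bar> \<le> 1"
    if "x < y" and xy: "x \<notin> crossing_params D" "y \<notin> crossing_params D" for x y
  proof (cases "\<exists>r \<in> crossing_params D. x < r \<and> r < y")
    case True
    then obtain r where "r \<in> crossing_params D" "x < r" "r < y" by blast
    then obtain p where p: "p \<in> crossing_params D" "x < p" "p < y"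
      and gap: "\<And>r. x < r \<Longrightarrow> r < p \<Longrightarrow> r \<notin> crossing_params D"
      using next_crossing_param[OF kd, of r x] by (metis order_le_less_trans)
    show ?thesis
      using alternating_warping_degree_diff[OF kd alt xy p gap] by (auto split: if_splits)
  next
    case False
    have "c \<in> warping_crossings D (curve D y) \<longleftrightarrow> c \<in> warping_crossings D (curve D x)" for c
    proof (cases "c \<in> crossings D")
      case True
      then have "curve D r \<noteq> c" if "x < r" "r < y" for r
        using False that by (auto simp: crossing_params_def)
      then show ?thesis using that by (intro warping_crossings_not_passed[OF kd]) auto
    qed (simp add: warping_crossings_def)
    then have "warping_crossings D (curve D y) = warping_crossings D (curve D x)" by blast
    then show ?thesis by (simp add: warping_degree_def)
  qed
  show ?thesis
    using diff[of u v] diff[of v u] uv by (cases u v rule: linorder_cases) auto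
qed

section \<open>Crossing changes\<close>

lemma crossings_change_crossings [simp]: "crossings (change_crossings C D) = crossings D"
  by (simp add: change_crossings_def crossings_def)

lemma curve_change_crossings [simp]: "curve (change_crossings C D) = curve D"
  by (simp add: change_crossings_def)

lemma crossing_params_change_crossings [simp]:
  "crossing_params (change_crossings C D) = crossing_params D"
  by (simp add: crossing_params_def)

lemma knot_diagram_change_crossings:
  assumes kd: "knot_diagram D"
  shows "knot_diagram (change_crossings C D)"
proof -
  let ?O = "over (change_crossings C D)"
  have O: "t \<in> ?O \<longleftrightarrow> curve D t \<in> crossings D \<and> (t \<in> over D \<longleftrightarrow> curve D t \<notin> C)" for t
    by (simp add: change_crossings_def)
  have "t + 1 \<in> ?O \<longleftrightarrow> t \<in> ?O" for t
    using kd by (auto simp: O knot_diagram_def regular_closed_curve_def)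
  moreover have "s \<in> ?O \<longleftrightarrow> t \<notin> ?O" if st: "s - t \<notin> \<int>" "curve D s = curve D t" for s t
  proof -
    have "curve D t \<in> crossings D" using st unfolding crossings_def by blast
    then show ?thesis using over_iff_not_over[OF kd st] st by (simp add: O)
  qed
  ultimately show ?thesis
    using kd unfolding knot_diagram_def by (auto simp: O)
qed

lemma warping_degree_change_crossings_le:
  assumes kd: "knot_diagram D" and C: "C \<subseteq> crossings D"
  shows "warping_degree D b \<le> warping_degree (change_crossings C D) b + card C"
    and "warping_degree (change_crossings C D) b \<le> warping_degree D b + card C"
proof -
  let ?W = "warping_crossings D b" and ?W' = "warping_crossings (change_crossings C D) b"
  have finC: "finite C" using kd C by (auto simp: knot_diagram_def intro: finite_subset)
  have fin: "finite ?W" "finite ?W'"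
    using finite_warping_crossings knot_diagram_change_crossings kd by blast+
  have "s \<in> over (change_crossings C D) \<longleftrightarrow> s \<in> over D"
    if "curve D s \<in> crossings D - C" for s
    using that by (simp add: change_crossings_def)
  then have "c \<in> ?W \<longleftrightarrow> c \<in> ?W'" if "c \<notin> C" for c
    using that unfolding warping_crossings_def by fastforce
  then have "?W \<subseteq> ?W' \<union> C" "?W' \<subseteq> ?W \<union> C" by blast+
  then show "warping_degree D b \<le> warping_degree (change_crossings C D) b + card C"
    and "warping_degree (change_crossings C D) b \<le> warping_degree D b + card C"
    unfolding warping_degree_def using fin finC
    by (meson card_Un_le card_mono finite_UnI order_trans)+
qed

section \<open>The span of a diagram\<close>

lemma edge_in_one_period:
  assumes kd: "knot_diagram D" and st: "consecutive D s t"
  obtains x y where "x \<in> crossing_params D \<inter> {0..2}" "y \<in> crossing_params D \<inter> {0..2}"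
    "curve D ` {s..t} = curve D ` {x..y}"
proof -
  let ?n = "\<lfloor>s\<rfloor>"
  let ?x = "s + of_int (- ?n)" and ?y = "t + of_int (- ?n)"
  have cp: "s \<in> crossing_params D" "t \<in> crossing_params D" "s < t"
    using st by (auto simp: consecutive_def crossing_params_def)
  \<comment> \<open>The crossing at \<open>s\<close> recurs at \<open>s + 1\<close>, so an edge fills at most one period.\<close>
  have "t \<le> s + 1"
  proof (rule ccontr)
    assume "\<not> t \<le> s + 1"
    then have "s + 1 \<in> {s<..<t}" by auto
    then show False
      using crossing_params_add_int[OF kd cp(1), of 1] st
      by (auto simp: consecutive_def crossing_params_def)
  qed
  have x: "0 \<le> ?x" "?x \<le> 1" by linarith+
  have y: "0 \<le> ?y" "?y \<le> 2" using x cp(3) \<open>t \<le> s + 1\<close> by linarith+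
  show thesis
  proof (rule that[of ?x ?y])
    show "?x \<in> crossing_params D \<inter> {0..2}" "?y \<in> crossing_params D \<inter> {0..2}"
      using crossing_params_add_int[OF kd cp(1), of "- ?n"]
        crossing_params_add_int[OF kd cp(2), of "- ?n"] x y by auto
    have "{?x..?y} = (\<lambda>r. r + of_int (- ?n)) ` {s..t}"
      by (simp only: image_add_atLeastAtMost')
    then show "curve D ` {s..t} = curve D ` {?x..?y}"
      using curve_add_int[OF kd] by (simp only: image_image)
  qed
qed

text \<open>
  The warping polynomial is a sum over the edges, which by convention would be zero if there were
  infinitely many of them.
\<close>

lemma finite_edges:
  assumes kd: "knot_diagram D"
  shows "finite (edges D)"
proof (cases "crossings D = {}")
  case False
  let ?P = "crossing_params D \<inter> {0..2}"
  have "edges D \<subseteq> (\<lambda>(x, y). curve D ` {x..y}) ` (?P \<times> ?P)"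
  proof
    fix e assume "e \<in> edges D"
    then obtain s t where e: "e = curve D ` {s..t}" and "consecutive D s t"
      using False by (auto simp: edges_def)
    then obtain x y where "x \<in> ?P" "y \<in> ?P" "curve D ` {s..t} = curve D ` {x..y}"
      using edge_in_one_period[OF kd] by blast
    then show "e \<in> (\<lambda>(x, y). curve D ` {x..y}) ` (?P \<times> ?P)"
      unfolding e by (intro image_eqI[where x = "(x, y)"]) auto
  qed
  then show ?thesis
    by (rule finite_subset) (intro finite_imageI finite_cartesian_product finite_crossing_params_Icc[OF kd])
qed (simp add: edges_def)

text \<open>
  A crossing recurs one period later, so some crossing follows it and closes an edge.  Together with
  the finiteness of the set of edges this makes the maximum and minimum in the span attained.
\<close>

lemma edges_nonempty:
  assumes kd: "knot_diagram D"
  shows "edges D \<noteq> {}"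
proof (cases "crossings D = {}")
  case False
  then obtain s where s: "s \<in> crossing_params D"
    unfolding crossing_params_def crossings_def by blast
  then have "s + 1 \<in> crossing_params D" using crossing_params_add_int[OF kd, of s 1] by simp
  then obtain t where "t \<in> crossing_params D" "s < t"
    "\<And>r. s < r \<Longrightarrow> r < t \<Longrightarrow> r \<notin> crossing_params D"
    using next_crossing_param[OF kd, of "s + 1" s] by auto
  then have "consecutive D s t" using s by (auto simp: consecutive_def crossing_params_def)
  then show ?thesis using False by (auto simp: edges_def)
qed (simp add: edges_def)

lemma edge_warping_degree_base_point:
  assumes "e \<in> edges D"
  obtains u where "u \<notin> crossing_params D" "edge_warping_degree D e = warping_degree D (curve D u)"
proof -
  have "e \<subseteq> range (curve D)" using assms by (auto simp: edges_def split: if_splits)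
  have "e - crossings D \<noteq> {}"
  proof (cases "crossings D = {}")
    case False
    then obtain s t where e: "e = curve D ` {s..t}" and st: "consecutive D s t"
      using assms by (auto simp: edges_def)
    then have "(s + t) / 2 \<in> {s<..<t}" by (auto simp: consecutive_def field_simps)
    then have "curve D ((s + t) / 2) \<in> e - crossings D"
      using st unfolding e consecutive_def by (auto intro!: imageI)
    then show ?thesis by blast
  qed (use assms in \<open>auto simp: edges_def\<close>)
  then have "(SOME b. b \<in> e - crossings D) \<in> e - crossings D" by (subst some_in_eq)
  then obtain u where "(SOME b. b \<in> e - crossings D) = curve D u" "curve D u \<notin> crossings D"
    using \<open>e \<subseteq> range (curve D)\<close> by auto
  then show thesis
    using that[of u] by (simp add: edge_warping_degree_def crossing_params_def)
qed

text \<open>The coefficients count edges, so nothing cancels.\<close>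

lemma coeff_warping_polynomial_nonzero:
  assumes kd: "knot_diagram D"
  shows "{n. coeff (warping_polynomial D) n \<noteq> 0} = edge_warping_degree D ` edges D"
proof -
  have "coeff (warping_polynomial D) n \<noteq> 0 \<longleftrightarrow> n \<in> edge_warping_degree D ` edges D" for n
    unfolding warping_polynomial_def coeff_sum coeff_monom
    using finite_edges[OF kd] by (subst sum_nonneg_eq_0_iff) auto
  then show ?thesis by blast
qed

lemma diagram_span_le:
  assumes kd: "knot_diagram D" and C: "C \<subseteq> crossings D"
    and alt: "alternating (change_crossings C D)"
  shows "diagram_span D \<le> 2 * card C + 1"
proof -
  let ?E = "change_crossings C D" and ?S = "edge_warping_degree D ` edges D"
  have "finite ?S" "?S \<noteq> {}" using finite_edges[OF kd] edges_nonempty[OF kd] by auto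
  then have "Max ?S \<in> ?S" "Min ?S \<in> ?S" by simp_all
  have base: "\<exists>u. u \<notin> crossing_params D \<and> n = warping_degree D (curve D u)" if "n \<in> ?S" for n
    using that edge_warping_degree_base_point by blast
  obtain u v where uv: "u \<notin> crossing_params D" "v \<notin> crossing_params D"
    and max: "Max ?S = warping_degree D (curve D u)"
    and min: "Min ?S = warping_degree D (curve D v)"
    using base[OF \<open>Max ?S \<in> ?S\<close>] base[OF \<open>Min ?S \<in> ?S\<close>] by blast
  have "warping_degree D (curve D u) \<le> warping_degree ?E (curve D u) + card C"
    by (rule warping_degree_change_crossings_le[OF kd C])
  also have "warping_degree ?E (curve D u) \<le> warping_degree ?E (curve D v) + 1"
    using alternating_warping_degree_le[OF knot_diagram_change_crossings[OF kd] alt] uv by simp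
  also have "warping_degree ?E (curve D v) \<le> warping_degree D (curve D v) + card C"
    by (rule warping_degree_change_crossings_le[OF kd C])
  finally show ?thesis
    unfolding diagram_span_def coeff_warping_polynomial_nonzero[OF kd] max min by simp
qed

section \<open>The span of a knot\<close>

lemma INF_enat_attained:
  fixes f :: "'a \<Rightarrow> enat"
  assumes "(INF x\<in>A. f x) = enat n"
  obtains x where "x \<in> A" "f x = enat n"
proof -
  have "A \<noteq> {}" using assms by (auto simp: top_enat_def)
  then obtain a where "a \<in> A" by blast
  then have "(INF x\<in>A. f x) \<in> f ` A" by (intro wellorder_InfI[of "f a"] imageI)
  then show thesis using that assms by auto
qed

theorem theorem1p2:
  fixes K :: "real \<Rightarrow> real^3"
  assumes "knot K"
  shows "(ereal_of_enat (knot_span K) - 1) / 2 \<le> ereal_of_enat (knot_dalt K)"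
proof (cases "knot_dalt K")
  case (enat n)
  then obtain D where D: "diagram_of D K" and dalt: "diagram_dalt D = enat n"
    unfolding knot_dalt_def by (rule INF_enat_attained) simp
  from dalt obtain C where C: "C \<subseteq> crossings D" "alternating (change_crossings C D)" "card C = n"
    unfolding diagram_dalt_def by (rule INF_enat_attained) auto
  have "knot_span K \<le> enat (diagram_span D)"
    unfolding knot_span_def using D by (auto intro: INF_lower)
  also have "\<dots> \<le> enat (2 * n + 1)"
    using diagram_span_le[of D C] C D by (auto simp: diagram_of_def)
  finally obtain m where m: "knot_span K = enat m" "m \<le> 2 * n + 1"
    by (cases "knot_span K") auto
  then have "(real m - 1) / 2 \<le> real n" by simp
  then show ?thesis
    by (simp add: m enat one_ereal_def numeral_eq_ereal)
qed simp

end
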